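(* Let $\alpha>-1$ be real and let $q\in\mathbb{N}=\{0,1,2,\dots\}$. The monic polynomial sequence $(P_n^{\alpha,q})_{n\ge 0}$, orthogonal on $[-1,1]$ with respect to the signed weight $x^{2q+1}(1-x^2)^{\alpha}(1-x)$, satisfies for every $n\ge 0$ the three-term recurrence relation $$P_{n+2}^{\alpha,q}(x)=(x-\beta_{n+1}^{\alpha,q})P_{n+1}^{\alpha,q}(x)-\gamma_{n+1}^{\alpha,q}P_n^{\alpha,q}(x),$$ with $P_0^{\alpha,q}(x)=1$, $P_1^{\alpha,q}(x)=x-\beta_0^{\alpha,q}$, where $$\beta_n^{\alpha,q}=(-1)^{n+1}\qquad (n\ge 0),$$ $$\gamma_{2n}^{\alpha,q}=-2\,\frac{n(2n+2q+1)}{(4n+2\alpha+2q+1)(4n+2\alpha+2q+3)}\qquad (n\ge 1),$$ $$\gamma_{2n+1}^{\alpha,q}=-2\,\frac{(n+\alpha+1)(2n+2\alpha+2q+3)}{(4n+2\alpha+2q+3)(4n+2\alpha+2q+5)}\qquad (n\ge 0).$$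
   Context: For real $\alpha>-1$ and $q\in\mathbb{N}=\{0,1,2,\dots\}$, let $w_{\alpha,q}(x)=x^{2q+1}(1-x^2)^{\alpha}(1-x)$ on $[-1,1]$ (a weight that changes sign at $0$). $(P_n^{\alpha,q})_{n\ge0}$ denotes the monic orthogonal polynomial sequence for $w_{\alpha,q}$: each $P_n^{\alpha,q}$ is a monic polynomial of degree exactly $n$, $\int_{-1}^1 w_{\alpha,q}(x)x^kP_n^{\alpha,q}(x)\,dx=0$ for $0\le k\le n-1$, and $\int_{-1}^1 w_{\alpha,q}(x)x^nP_n^{\alpha,q}(x)\,dx\ne 0$. *)

theory Defs
  imports "HOL-Analysis.Analysis" "HOL-Computational_Algebra.Polynomial"
begin

text \<open>
  For \<open>\<alpha> < 0\<close> the weight is unbounded at the endpoints; \<open>powr\<close> assigns it the value 0 there,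
  which is irrelevant for Lebesgue integrals.
\<close>

definition weight :: "real \<Rightarrow> nat \<Rightarrow> real \<Rightarrow> real" where
  "weight \<alpha> q x = x ^ (2 * q + 1) * (1 - x\<^sup>2) powr \<alpha> * (1 - x)"

text \<open>The weight may change sign, so the non-vanishing condition is not automatic.\<close>

definition monic_OPS :: "(real \<Rightarrow> real) \<Rightarrow> (nat \<Rightarrow> real poly) \<Rightarrow> bool" where
  "monic_OPS w P \<longleftrightarrow>
     (\<forall>n. degree (P n) = n \<and> lead_coeff (P n) = 1 \<and>
          (\<forall>k<n. (LBINT x:{-1..1}. w x * x ^ k * poly (P n) x) = 0) \<and>
          (LBINT x:{-1..1}. w x * x ^ n * poly (P n) x) \<noteq> 0)"

end

theory Submission
  imports Defs
begin

text \<open>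
  Write \<open>L\<close> for integration against the weight, and put \<open>a = q + 3/2\<close>, \<open>b = \<alpha> + 1\<close>.  The
  symmetric factor \<open>(1 - x^2)^\<alpha>\<close> has vanishing odd moments, so multiplying \<open>x^(2q+1)\<close> by \<open>1 - x\<close> leaves
  one even power in each case, and the moments of the weight come in opposite pairs:
  \<open>L(x^(2k+1)) = - L(x^(2k)) = \<kappa> Beta(a + k, b)\<close> with \<open>\<kappa> > 0\<close>.

  Behind the theorem are Jacobi polynomials on \<open>[0,1]\<close>: \<open>P_(2n)(x) = p_n(x^2)\<close> and
  \<open>P_(2n+1)(x) = (x + 1) r_n(x^2)\<close>, where \<open>p_n\<close> and \<open>r_n\<close> are orthogonal for
  \<open>t^(a-1) (1-t)^(b-1)\<close> and \<open>t^(a-1) (1-t)^b\<close>.  By Rodrigues' formula and integration by parts, the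
  integral of \<open>t^k p_n(t)\<close> against the first weight is an explicit constant times
  \<open>k (k-1) ... (k-n+1) Beta(a + k, b + n)\<close>, for every \<open>k\<close> and not only for \<open>k \<le> n\<close>; similarly for
  \<open>r_n\<close>.

  Having such a formula for all \<open>k\<close> makes a purely algebraic proof possible.  Define
  \<open>rec_OPS\<close> by the claimed recurrence.  The recurrence expresses \<open>L(x^m P_(n+2))\<close> through
  \<open>L(x^m P_(n+1))\<close>, \<open>L(x^(m+1) P_(n+1))\<close> and \<open>L(x^m P_n)\<close>, so an induction proves closed forms for
  all pairings simultaneously (\<open>rec_OPS_pairings\<close>); its two steps, \<open>even_pairing_Suc\<close> and
  \<open>odd_pairing_Suc\<close>, are rational identities that follow from the shift rules of the Beta function.
  Orthogonality is then visible from the zeros of the falling factorial, and the non-vanishing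
  condition from the positivity of the remaining factors.  Finally a monic orthogonal sequence is
  determined by its weight (\<open>monic_OPS_unique\<close>), so every such sequence is \<open>rec_OPS\<close>.
\<close>

section \<open>Monic orthogonal sequences of a weight\<close>

definition pairing :: "(real \<Rightarrow> real) \<Rightarrow> real poly \<Rightarrow> real" where
  "pairing w p = (LBINT x:{-1..1}. w x * poly p x)"

lemma monic_OPS_iff_pairing:
  "monic_OPS w P \<longleftrightarrow>
     (\<forall>n. degree (P n) = n \<and> lead_coeff (P n) = 1 \<and>
          (\<forall>k<n. pairing w (monom 1 k * P n) = 0) \<and> pairing w (monom 1 n * P n) \<noteq> 0)"
  by (simp add: monic_OPS_def pairing_def poly_monom mult.assoc)

locale moment_functional =
  fixes w :: "real \<Rightarrow> real"
  assumes integrable: "set_integrable lborel {-1..1} (\<lambda>x. w x * poly p x)"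
begin

lemma pairing_add: "pairing w (p + r) = pairing w p + pairing w r"
  unfolding pairing_def by (simp add: distrib_left set_integral_add(2)[OF integrable integrable])

lemma pairing_smult: "pairing w (smult c p) = c * pairing w p"
  unfolding pairing_def by (simp add: mult.left_commute[of _ c])

lemma pairing_diff: "pairing w (p - r) = pairing w p - pairing w r"
  using pairing_add[of "p - r" r] by simp

lemma pairing_0: "pairing w 0 = 0"
  using pairing_smult[of 0 0] by simp

lemma pairing_sum: "pairing w (\<Sum>i\<in>A. f i) = (\<Sum>i\<in>A. pairing w (f i))"
  by (induction A rule: infinite_finite_induct) (simp_all add: pairing_0 pairing_add)

lemma pairing_monom_linear_mult:
  "pairing w (monom 1 m * ([:c, 1:] * p)) =
     c * pairing w (monom 1 m * p) + pairing w (monom 1 (Suc m) * p)"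
proof -
  have "monom 1 m * ([:c, 1:] * p) = smult c (monom 1 m * p) + monom 1 (Suc m) * p"
    by (simp add: monom_Suc algebra_simps)
  then show ?thesis
    by (simp add: pairing_add pairing_smult)
qed

lemma pairing_orthogonal_mult:
  assumes "\<And>k. k < n \<Longrightarrow> pairing w (monom 1 k * Q) = 0" and "degree r \<le> n"
  shows "pairing w (r * Q) = coeff r n * pairing w (monom 1 n * Q)"
proof -
  have "r * Q = (\<Sum>i\<le>n. smult (coeff r i) (monom 1 i * Q))"
    by (subst poly_as_sum_of_monoms'[OF assms(2), symmetric])
       (simp add: sum_distrib_right smult_monom flip: mult_smult_left)
  then have "pairing w (r * Q) = (\<Sum>i\<le>n. coeff r i * pairing w (monom 1 i * Q))"
    by (simp add: pairing_sum pairing_smult)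
  also have "\<dots> = coeff r n * pairing w (monom 1 n * Q)"
    using assms(1) by (subst sum.remove[of _ n]) (auto intro!: sum.neutral)
  finally show ?thesis .
qed

text \<open>
  The difference \<open>D\<close> of two candidates for degree \<open>n\<close> has degree \<open>d < n\<close> and is orthogonal to
  everything of degree below \<open>n\<close>, in particular to \<open>P d\<close>; but pairing \<open>D\<close> with \<open>P d\<close> returns
  the leading coefficient of \<open>D\<close> times the nonzero number attached to \<open>P d\<close>.  Positivity of the
  weight is replaced here by the non-vanishing condition.
\<close>

lemma monic_OPS_unique:
  assumes P: "monic_OPS w P" and Q: "monic_OPS w Q"
  shows "P = Q"
proof
  fix n
  define D where "D = P n - Q n"
  have "D = 0"
  proof (rule ccontr)
    assume "D \<noteq> 0"
    let ?d = "degree D"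
    have PQ: "degree (P n) = n" "degree (Q n) = n" "coeff (P n) n = 1" "coeff (Q n) n = 1"
      using P Q by (metis monic_OPS_iff_pairing)+
    have "?d \<le> n"
      unfolding D_def using PQ by (intro degree_diff_le) auto
    moreover have "coeff D n = 0"
      by (simp add: D_def PQ)
    ultimately have d: "?d < n"
      using \<open>D \<noteq> 0\<close> by (metis le_neq_implies_less leading_coeff_0_iff)
    have "pairing w (monom 1 k * D) = 0" if "k < n" for k
      using that P Q by (simp add: D_def right_diff_distrib pairing_diff monic_OPS_iff_pairing)
    moreover have "degree (P ?d) \<le> n" "coeff (P ?d) n = 0"
      using P d by (simp_all add: monic_OPS_iff_pairing coeff_eq_0)
    ultimately have "pairing w (P ?d * D) = 0"
      using pairing_orthogonal_mult[of n D "P ?d"] by simp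
    moreover have "pairing w (D * P ?d) = lead_coeff D * pairing w (monom 1 ?d * P ?d)"
      using P by (intro pairing_orthogonal_mult) (auto simp: monic_OPS_iff_pairing)
    moreover have "pairing w (monom 1 ?d * P ?d) \<noteq> 0"
      using P by (simp add: monic_OPS_iff_pairing)
    ultimately show False
      using \<open>D \<noteq> 0\<close> by (simp add: mult.commute)
  qed
  then show "P n = Q n"
    by (simp add: D_def)
qed

end

section \<open>Moments of the symmetric weight\<close>

definition ultra :: "real \<Rightarrow> real \<Rightarrow> real" where
  "ultra \<alpha> x = (1 - x\<^sup>2) powr \<alpha>"

text \<open>
  The substitution \<open>t = (x + 1) / 2\<close> turns \<open>1 - x^2\<close> into \<open>4 t (1 - t)\<close>.  This is the only integral
  that is evaluated; all other moments are reduced to it or to zero.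
\<close>

lemma has_integral_ultra:
  assumes "\<alpha> > -1"
  shows "(ultra \<alpha> has_integral 2 * 4 powr \<alpha> * Beta (\<alpha> + 1) (\<alpha> + 1)) {-1..1}"
proof -
  let ?f = "\<lambda>t :: real. t powr \<alpha> * (1 - t) powr \<alpha>"
  have "(?f has_integral Beta (\<alpha> + 1) (\<alpha> + 1)) (cbox 0 1)"
    using has_integral_Beta_real[of "\<alpha> + 1" "\<alpha> + 1"] assms by simp
  from has_integral_affinity'[OF this, of "1/2" "1/2"]
  have "((\<lambda>x. ?f ((x + 1) / 2)) has_integral 2 * Beta (\<alpha> + 1) (\<alpha> + 1)) {-1..1}"
    by (simp add: field_simps)
  then have "((\<lambda>x. 4 powr \<alpha> * ?f ((x + 1) / 2)) has_integral
      4 powr \<alpha> * (2 * Beta (\<alpha> + 1) (\<alpha> + 1))) {-1..1}"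
    by (rule has_integral_mult_right)
  moreover have "4 powr \<alpha> * ?f ((x + 1) / 2) = ultra \<alpha> x" if "x \<in> {-1..1}" for x
  proof -
    have "1 - x\<^sup>2 = 4 * (((x + 1) / 2) * (1 - (x + 1) / 2))"
      by (simp add: field_simps power2_eq_square)
    then show ?thesis
      using that unfolding ultra_def by (simp only: powr_mult)
  qed
  ultimately show ?thesis
    by (subst has_integral_cong[symmetric]) (auto simp: mult_ac)
qed

text \<open>
  Integrability of the singular factor comes from the Beta integral above, since it is nonnegative;
  a polynomial is bounded on the interval.
\<close>

lemma ultra_moment_functional:
  assumes "\<alpha> > -1"
  shows "moment_functional (ultra \<alpha>)"
proof
  fix p :: "real poly"
  have meas [measurable]: "ultra \<alpha> \<in> borel_measurable borel"
    unfolding ultra_def by measurable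
  have [measurable]: "poly p \<in> borel_measurable borel"
    by (intro borel_measurable_continuous_onI continuous_intros)
  have "ultra \<alpha> absolutely_integrable_on {-1..1}"
    using has_integral_ultra[OF assms]
    by (intro nonnegative_absolutely_integrable_1) (auto simp: ultra_def)
  then have "set_integrable lborel {-1..1} (ultra \<alpha>)"
    unfolding set_integrable_def by (subst (asm) integrable_completion) auto
  then have bound: "set_integrable lborel {-1..1} (\<lambda>x. B * ultra \<alpha> x)" for B
    by simp
  have "bounded (poly p ` {-1..1})"
    by (intro compact_imp_bounded compact_continuous_image continuous_intros) auto
  then obtain B where B: "\<And>x. x \<in> {-1..1} \<Longrightarrow> \<bar>poly p x\<bar> \<le> B"
    unfolding bounded_iff by (metis image_eqI real_norm_def)
  have "norm (ultra \<alpha> x * poly p x) \<le> norm (B * ultra \<alpha> x)" if "x \<in> {-1..1}" for x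
  proof -
    have "\<bar>poly p x\<bar> \<le> \<bar>B\<bar>"
      using B[OF that] by linarith
    then show ?thesis
      by (simp add: abs_mult mult.commute mult_right_mono)
  qed
  then show "set_integrable lborel {-1..1} (\<lambda>x. ultra \<alpha> x * poly p x)"
    by (intro set_integrable_bound[OF bound[of B]]) (auto simp: set_borel_measurable_def)
qed

text \<open>
  The difference of the two integrands is the derivative of \<open>p(x) (1 - x^2)^(\<alpha>+1)\<close>.  As
  \<open>\<alpha> + 1 > 0\<close>, this function is continuous up to the endpoints and vanishes there, even when the
  weight itself is unbounded.
\<close>

lemma pairing_ultra_by_parts:
  assumes "\<alpha> > -1"
  shows "pairing (ultra \<alpha>) (pderiv p * [:1, 0, -1:]) =
    pairing (ultra \<alpha>) (smult (2 * (\<alpha> + 1)) (pCons 0 p))"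
proof -
  interpret moment_functional "ultra \<alpha>"
    using ultra_moment_functional[OF assms] .
  let ?r = "pderiv p * [:1, 0, -1:] - smult (2 * (\<alpha> + 1)) (pCons 0 p)"
  let ?F = "\<lambda>x. poly p x * (1 - x\<^sup>2) powr (\<alpha> + 1)"
  have "((\<lambda>x. ultra \<alpha> x * poly ?r x) has_integral ?F 1 - ?F (-1)) {-1..1}"
  proof (rule fundamental_theorem_of_calculus_interior)
    show "continuous_on {-1..1} ?F"
      using assms by (intro continuous_intros continuous_on_powr') (auto simp: abs_square_le_1)
  next
    fix x :: real
    assume x: "x \<in> {-1<..<1}"
    then have pos: "1 - x\<^sup>2 > 0"
      by (auto simp: abs_square_less_1)
    have split: "(1 - x\<^sup>2) powr (\<alpha> + 1) = (1 - x\<^sup>2) powr \<alpha> * (1 - x\<^sup>2)"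
      using pos by (subst powr_add) simp
    have "(?F has_real_derivative poly (pderiv p) x * (1 - x\<^sup>2) powr (\<alpha> + 1) +
        poly p x * ((\<alpha> + 1) * (1 - x\<^sup>2) powr \<alpha> * (- 2 * x))) (at x)"
      using pos by (auto intro!: derivative_eq_intros)
    also have "poly (pderiv p) x * (1 - x\<^sup>2) powr (\<alpha> + 1) +
        poly p x * ((\<alpha> + 1) * (1 - x\<^sup>2) powr \<alpha> * (- 2 * x)) = ultra \<alpha> x * poly ?r x"
      unfolding split ultra_def by (simp add: algebra_simps power2_eq_square)
    finally have "(?F has_real_derivative ultra \<alpha> x * poly ?r x) (at x)" .
    then show "(?F has_vector_derivative ultra \<alpha> x * poly ?r x) (at x)"
      by (simp add: has_real_derivative_iff_has_vector_derivative)
  qed auto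
  then have "pairing (ultra \<alpha>) ?r = 0"
    unfolding pairing_def set_borel_integral_eq_integral(2)[OF integrable]
    using assms by (simp add: integral_unique)
  then show ?thesis
    by (simp only: pairing_diff)
qed

text \<open>
  Integration by parts with \<open>p(x) = x^n\<close>.  The case \<open>n = 0\<close> is meant to be included: its right-hand
  side is \<open>0\<close>, so it says that the first moment vanishes and starts the induction for the odd moments.
\<close>

lemma ultra_moment_Suc:
  assumes "\<alpha> > -1"
  shows "(real n + 2 * \<alpha> + 2) * pairing (ultra \<alpha>) (monom 1 (Suc n)) =
    real n * pairing (ultra \<alpha>) (monom 1 (n - 1))"
proof -
  interpret moment_functional "ultra \<alpha>"
    using ultra_moment_functional[OF assms] .
  have "pderiv (monom 1 n) * [:1, 0, -1:] =
      smult (real n) (monom 1 (n - 1)) - smult (real n) (monom 1 (Suc n))"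
    by (cases n) (simp_all add: pderiv_monom smult_monom, simp add: monom_Suc minus_monom)
  then have "pairing (ultra \<alpha>) (pderiv (monom 1 n) * [:1, 0, -1:]) =
      real n * pairing (ultra \<alpha>) (monom 1 (n - 1)) - real n * pairing (ultra \<alpha>) (monom 1 (Suc n))"
    by (simp only: pairing_diff pairing_smult)
  moreover have "pairing (ultra \<alpha>) (smult (2 * (\<alpha> + 1)) (pCons 0 (monom 1 n))) =
      2 * (\<alpha> + 1) * pairing (ultra \<alpha>) (monom 1 (Suc n))"
    by (simp only: pairing_smult monom_Suc)
  ultimately show ?thesis
    using pairing_ultra_by_parts[OF assms, of "monom 1 n"] by (simp add: algebra_simps)
qed

lemma ultra_odd_moment:
  assumes "\<alpha> > -1"
  shows "pairing (ultra \<alpha>) (monom 1 (2 * j + 1)) = 0"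
proof (induction j)
  case 0
  show ?case
    using ultra_moment_Suc[OF assms, of 0] assms by simp
next
  case (Suc j)
  then show ?case
    using ultra_moment_Suc[OF assms, of "2 * j + 2"] assms by simp
qed

lemma Beta_Suc_left:
  fixes x y :: real
  assumes "x > 0" "y > 0"
  shows "Beta (x + 1) y = x / (x + y) * Beta x y"
proof -
  have "x \<notin> \<int>\<^sub>\<le>\<^sub>0"
    using assms nonpos_Ints_nonpos by force
  from Beta_plus1_left[OF this, of y] show ?thesis
    using assms by (simp add: field_simps)
qed

lemma Beta_Suc_right:
  fixes x y :: real
  assumes "x > 0" "y > 0"
  shows "Beta x (y + 1) = y / (x + y) * Beta x y"
  using Beta_Suc_left[of y x] assms by (simp add: Beta_commute add.commute)

lemma Beta_real_pos: "Beta x y > 0" if "x > 0" "y > 0" for x y :: real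
  using that by (simp add: Beta_def Gamma_real_pos)

text \<open>
  The recursion for the moments is the one satisfied by the Beta function.  The true value of \<open>\<kappa>\<close>
  is \<open>1\<close>; it can stay unspecified because scaling a weight does not change its monic orthogonal
  polynomials.
\<close>

lemma ultra_even_moment:
  assumes "\<alpha> > -1"
  obtains \<kappa> where "\<kappa> > 0"
    "\<And>j. pairing (ultra \<alpha>) (monom 1 (2 * j)) = \<kappa> * Beta (real j + 1/2) (\<alpha> + 1)"
proof -
  interpret moment_functional "ultra \<alpha>"
    using ultra_moment_functional[OF assms] .
  define \<kappa> where "\<kappa> = pairing (ultra \<alpha>) 1 / Beta (1/2) (\<alpha> + 1)"
  have "pairing (ultra \<alpha>) 1 = 2 * 4 powr \<alpha> * Beta (\<alpha> + 1) (\<alpha> + 1)"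
    unfolding pairing_def set_borel_integral_eq_integral(2)[OF integrable]
    using has_integral_ultra[OF assms] by (simp add: integral_unique)
  then have "\<kappa> > 0"
    using assms by (simp add: \<kappa>_def Beta_real_pos)
  moreover have "pairing (ultra \<alpha>) (monom 1 (2 * j)) = \<kappa> * Beta (real j + 1/2) (\<alpha> + 1)" for j
  proof (induction j)
    case 0
    show ?case
      using Beta_real_pos[of "1/2" "\<alpha> + 1"] assms by (simp add: \<kappa>_def)
  next
    case (Suc j)
    have "(2 * real j + 2 * \<alpha> + 3) * pairing (ultra \<alpha>) (monom 1 (2 * Suc j)) =
        (2 * real j + 1) * (\<kappa> * Beta (real j + 1/2) (\<alpha> + 1))"
      using ultra_moment_Suc[OF assms, of "2 * j + 1"] Suc by (simp add: algebra_simps)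
    moreover have "Beta (real (Suc j) + 1/2) (\<alpha> + 1) =
        (2 * real j + 1) / (2 * real j + 2 * \<alpha> + 3) * Beta (real j + 1/2) (\<alpha> + 1)"
    proof -
      have "(real j + 1/2) / (real j + 1/2 + (\<alpha> + 1)) = (2 * real j + 1) / (2 * real j + 2 * \<alpha> + 3)"
        using assms by (simp add: field_simps)
      moreover have "real (Suc j) + 1/2 = real j + 1/2 + 1"
        by simp
      ultimately show ?thesis
        using Beta_Suc_left[of "real j + 1/2" "\<alpha> + 1"] assms by (simp only:)
    qed
    moreover have "2 * real j + 2 * \<alpha> + 3 \<noteq> 0"
      using assms by simp
    ultimately show ?case
      by (metis (no_types, lifting) mult.left_commute mult_cancel_left
          nonzero_mult_div_cancel_left
          times_divide_eq_left times_divide_eq_right)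
  qed
  ultimately show ?thesis
    using that by blast
qed

section \<open>Closed forms for the pairings with monomials\<close>

text \<open>
  Up to sign the constant in Rodrigues' formula for the monic Jacobi polynomial \<open>p_n\<close>; the product
  equals \<open>(s)_n / (s)_(2n)\<close> in Pochhammer symbols, with \<open>s = a + b - 1\<close>.
\<close>

definition jacobi_factor :: "real \<Rightarrow> real \<Rightarrow> nat \<Rightarrow> real" where
  "jacobi_factor a b n = (\<Prod>i<n. (real i + a + b - 1) / ((2 * real i + a + b - 1) * (2 * real i + a + b)))"

text \<open>
  The integral of \<open>t^k p_n(t)\<close> against \<open>t^(a-1) (1-t)^(b-1)\<close>, and below the integral of
  \<open>t^k r_n(t)\<close> against \<open>t^(a-1) (1-t)^b\<close>, in closed form.
\<close>

definition even_pairing :: "real \<Rightarrow> real \<Rightarrow> nat \<Rightarrow> nat \<Rightarrow> real" where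
  "even_pairing a b n k = jacobi_factor a b n * (\<Prod>i<n. real k - real i) * Beta (a + k) (b + n)"

definition odd_pairing :: "real \<Rightarrow> real \<Rightarrow> nat \<Rightarrow> nat \<Rightarrow> real" where
  "odd_pairing a b n k = jacobi_factor a b n * ((n + a + b - 1) / (2 * n + a + b - 1)) *
     (\<Prod>i<n. real k - real i) * Beta (a + k) (b + n + 1)"

text \<open>
  The coefficients \<open>\<gamma>_m\<close> of the theorem in terms of \<open>a = q + 3/2\<close> and \<open>b = \<alpha> + 1\<close>.  In these
  parameters the even and the odd coefficients have the same denominator.
\<close>

definition rec_coeff :: "real \<Rightarrow> real \<Rightarrow> nat \<Rightarrow> real" where
  "rec_coeff a b m = (let n = real (m div 2) in
     - (if even m then n * (n + a - 1) else (n + b) * (n + a + b - 1)) /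
       ((m + a + b - 2) * (m + a + b - 1)))"

text \<open>
  On the level of polynomials this is \<open>p_(n+1)(t) = (t - 1) r_n(t) - \<gamma>_(2n+1) p_n(t)\<close>, that is, the
  recurrence for \<open>P_(2n+2)\<close> with \<open>(x - 1) (x + 1) = t - 1\<close>.  After removing the common factors the
  identity is the partial fraction decomposition of \<open>(k - n) / (w z)\<close> with \<open>w = a + b + 2n\<close> and
  \<open>z = a + b + k + n\<close>, because \<open>z - w = k - n\<close>.
\<close>

lemma even_pairing_Suc:
  assumes "a > 0" "b > 0" "a + b > 1"
  shows "even_pairing a b (Suc n) k =
    - odd_pairing a b n k - rec_coeff a b (2 * n + 1) * even_pairing a b n k"
proof -
  define u where "u = n + a + b - 1"
  define v where "v = 2 * n + a + b - 1"
  define w where "w = 2 * n + a + b"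
  define z where "z = a + k + (b + n)"
  define f where "f = (\<Prod>i<n. real k - real i)"
  define A where "A = jacobi_factor a b n"
  define B where "B = Beta (a + k) (b + n)"
  have nz: "w \<noteq> 0" "z \<noteq> 0"
    using assms by (auto simp: w_def z_def)
  have A': "jacobi_factor a b (Suc n) = A * (u / (v * w))"
    by (simp add: jacobi_factor_def A_def u_def v_def w_def)
  have B': "Beta (a + k) (b + n + 1) = (b + n) / z * B"
    using Beta_Suc_right[of "a + k" "b + n"] assms by (simp add: B_def z_def)
  have lhs: "even_pairing a b (Suc n) k = A * (u / (v * w)) * (f * (real k - n)) * ((b + n) / z * B)"
    unfolding even_pairing_def A' B'[symmetric] f_def by (simp add: add_ac)
  have odd: "odd_pairing a b n k = A * (u / v) * f * ((b + n) / z * B)"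
    unfolding odd_pairing_def B' A_def u_def v_def f_def by simp
  have even: "even_pairing a b n k = A * f * B"
    unfolding even_pairing_def A_def f_def B_def by simp
  have gam: "rec_coeff a b (2 * n + 1) = - ((n + b) * u / (v * w))"
  proof -
    have "real (2 * n + 1) + a + b - 2 = v" "real (2 * n + 1) + a + b - 1 = w"
      by (simp_all add: v_def w_def)
    then show ?thesis
      unfolding rec_coeff_def Let_def by (simp only:) (simp add: u_def)
  qed
  have "(real k - n) / (w * z) = 1 / w - 1 / z"
    using nz by (simp add: field_simps) (simp add: w_def z_def)
  moreover define c where "c = A * f * B * u * (b + n) / v"
  ultimately have "c * ((real k - n) / (w * z)) = c * (1 / w) - c * (1 / z)"
    by (simp only: right_diff_distrib)
  moreover have "even_pairing a b (Suc n) k = c * ((real k - n) / (w * z))"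
    unfolding lhs c_def by (simp add: mult_ac)
  moreover have "odd_pairing a b n k = c * (1 / z)"
    unfolding odd c_def by (simp add: mult_ac)
  moreover have "rec_coeff a b (2 * n + 1) * even_pairing a b n k = - (c * (1 / w))"
    unfolding gam even c_def by (simp add: mult_ac add_ac)
  ultimately show ?thesis
    by linarith
qed

text \<open>
  Here the polynomial relation is \<open>r_(n+1)(t) = p_(n+1)(t) - \<gamma>_(2n+2) r_n(t)\<close>.  The additional factor
  \<open>1 - t\<close> of the weight of \<open>r_(n+1)\<close> accounts for the difference of two consecutive values of \<open>k\<close>.
\<close>

lemma odd_pairing_Suc:
  assumes "a > 0" "b > 0" "a + b > 1"
  shows "odd_pairing a b (Suc n) k =
    even_pairing a b (Suc n) k - even_pairing a b (Suc n) (Suc k) -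
    rec_coeff a b (2 * n + 2) * odd_pairing a b n k"
proof -
  define u where "u = n + a + b - 1"
  define v where "v = 2 * n + a + b - 1"
  define w where "w = 2 * n + a + b"
  define z where "z = a + k + (b + n + 1)"
  define f where "f = (\<Prod>i<n. real k - real i)"
  define A where "A = jacobi_factor a b n"
  define B where "B = Beta (a + k) (b + n + 1)"
  have nz: "w \<noteq> 0" "w + 1 \<noteq> 0" "z \<noteq> 0"
    using assms by (auto simp: w_def z_def)
  have A': "jacobi_factor a b (Suc n) = A * (u / (v * w))"
    by (simp add: jacobi_factor_def A_def u_def v_def w_def)
  have Br: "Beta (a + k) (b + Suc n + 1) = (b + n + 1) / z * B"
    using Beta_Suc_right[of "a + k" "b + n + 1"] assms by (simp add: B_def z_def add_ac)
  have Bl: "Beta (a + Suc k) (b + Suc n) = (a + k) / z * B"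
    using Beta_Suc_left[of "a + k" "b + n + 1"] assms by (simp add: B_def z_def add_ac)
  \<comment> \<open>Shifting \<open>k\<close> moves the window of the falling factorial, so the common factor is the product
    of length \<open>n\<close>, not \<open>Suc n\<close>; this avoids dividing by \<open>k - n\<close>.\<close>
  have fl: "(\<Prod>i<Suc n. real (Suc k) - real i) = (k + 1) * f"
    by (subst prod.lessThan_Suc_shift) (simp add: f_def add_ac)
  have lhs: "odd_pairing a b (Suc n) k =
      A * (u / (v * w)) * ((n + a + b) / (w + 1)) * (f * (real k - n)) * ((b + n + 1) / z * B)"
    unfolding odd_pairing_def A' Br f_def w_def by (simp add: add_ac)
  have e1: "even_pairing a b (Suc n) k = A * (u / (v * w)) * (f * (real k - n)) * B"
    unfolding even_pairing_def A' B_def f_def by (simp add: add_ac)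
  have e2: "even_pairing a b (Suc n) (Suc k) = A * (u / (v * w)) * ((k + 1) * f) * ((a + k) / z * B)"
    unfolding even_pairing_def A' Bl fl by simp
  have odd: "odd_pairing a b n k = A * (u / v) * f * B"
    unfolding odd_pairing_def A_def f_def B_def u_def v_def by simp
  have gam: "rec_coeff a b (2 * n + 2) = - ((n + 1) * (n + a) / (w * (w + 1)))"
    by (simp add: rec_coeff_def Let_def w_def add_ac)
  \<comment> \<open>What remains after the common factor is removed and denominators are cleared: a polynomial
    identity in \<open>a\<close>, \<open>b\<close>, \<open>n\<close> and \<open>k\<close>.\<close>
  have "(n + a + b) * (real k - n) * (b + n + 1) =
      (real k - n) * z * (w + 1) - (k + 1) * (a + k) * (w + 1) + (n + 1) * (n + a) * z"
    unfolding z_def w_def by (simp add: algebra_simps)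
  then have "(n + a + b) / (w + 1) * (real k - n) * ((b + n + 1) / z) =
      (real k - n) - (k + 1) * ((a + k) / z) + (n + 1) * (n + a) / (w + 1)"
    using nz by (simp add: divide_simps) (simp add: algebra_simps)
  moreover define c where "c = A * f * B * u / (v * w)"
  ultimately have "c * ((n + a + b) / (w + 1) * (real k - n) * ((b + n + 1) / z)) =
      c * (real k - n) - c * ((k + 1) * ((a + k) / z)) + c * ((n + 1) * (n + a) / (w + 1))"
    by (simp only: distrib_left right_diff_distrib)
  moreover have "odd_pairing a b (Suc n) k =
      c * ((n + a + b) / (w + 1) * (real k - n) * ((b + n + 1) / z))"
    unfolding lhs c_def by (simp add: mult_ac)
  moreover have "even_pairing a b (Suc n) k = c * (real k - n)"
    unfolding e1 c_def by (simp add: mult_ac)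
  moreover have "even_pairing a b (Suc n) (Suc k) = c * ((k + 1) * ((a + k) / z))"
    unfolding e2 c_def by (simp add: mult_ac)
  moreover have "rec_coeff a b (2 * n + 2) * odd_pairing a b n k =
      - (c * ((n + 1) * (n + a) / (w + 1)))"
    unfolding gam odd c_def by (simp add: mult_ac)
  ultimately show ?thesis
    by linarith
qed

lemma jacobi_factor_pos:
  assumes "a + b > 1"
  shows "jacobi_factor a b n > 0"
  unfolding jacobi_factor_def using assms by (intro prod_pos) (auto intro!: divide_pos_pos mult_pos_pos)

lemma falling_factorial_eq_0: "k < n \<Longrightarrow> (\<Prod>i<n. real k - real i) = 0"
  by (auto simp: prod_zero_iff)

lemma falling_factorial_pos: "(\<Prod>i<n. real n - real i) > 0"
  by (intro prod_pos) auto

section \<open>The sequence generated by the recurrence\<close>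

text \<open>
  The index of the coefficient \<open>\<beta>_(n+1) = (-1)^(n+2)\<close> explains the sign \<open>(-1)^n\<close>; the second
  equation is \<open>x - \<beta>_0\<close> with \<open>\<beta>_0 = -1\<close>.
\<close>

fun rec_OPS :: "real \<Rightarrow> real \<Rightarrow> nat \<Rightarrow> real poly" where
  "rec_OPS a b 0 = 1"
| "rec_OPS a b (Suc 0) = [:1, 1:]"
| "rec_OPS a b (Suc (Suc n)) =
     [:- ((-1) ^ n), 1:] * rec_OPS a b (Suc n) - smult (rec_coeff a b (Suc n)) (rec_OPS a b n)"

lemma rec_OPS_monic:
  "degree (rec_OPS a b n) = n \<and> lead_coeff (rec_OPS a b n) = 1"
proof (induction n rule: induct_nat_012)
  case (ge2 n)
  let ?P = "[:- ((-1) ^ n), 1:] * rec_OPS a b (Suc n)"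
  let ?R = "smult (rec_coeff a b (Suc n)) (rec_OPS a b n)"
  have "rec_OPS a b (Suc n) \<noteq> 0"
    using ge2 by (metis leading_coeff_0_iff zero_neq_one)
  then have "degree ?P = Suc (Suc n)"
    using ge2 by (subst degree_mult_eq) auto
  moreover have "lead_coeff ?P = 1"
  proof -
    have "lead_coeff (rec_OPS a b (Suc n)) = 1"
      using ge2 by blast
    then show ?thesis
      unfolding lead_coeff_mult by (simp only:) simp
  qed
  moreover have "degree ?R \<le> n"
    using ge2 degree_smult_le[of _ "rec_OPS a b n"] by metis
  moreover have "coeff ?R (Suc (Suc n)) = 0"
    using \<open>degree ?R \<le> n\<close> by (intro coeff_eq_0) simp
  ultimately have d: "degree (?P - ?R) = Suc (Suc n)" "coeff (?P - ?R) (Suc (Suc n)) = 1"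
    using degree_add_eq_left[of "- ?R" ?P] by (simp_all del: mult_pCons_left)
  then show ?case
    by (simp only: rec_OPS.simps)
qed auto

context moment_functional
begin

text \<open>
  The values do not depend on any bound on \<open>k\<close>, which is what makes the induction close: the pairing
  of \<open>x^m\<close> with a new polynomial needs that of \<open>x^(m+1)\<close> with the previous one.  The vanishing third
  component holds because opposite moments cancel in \<open>x^(2k) (x + 1) r_n(x^2)\<close>.
\<close>

lemma rec_OPS_pairings:
  assumes a: "a > 0" and b: "b > 0" and ab: "a + b > 1"
    and even_moment: "\<And>k. pairing w (monom 1 (2 * k)) = - (\<kappa> * Beta (a + k) b)"
    and odd_moment: "\<And>k. pairing w (monom 1 (2 * k + 1)) = \<kappa> * Beta (a + k) b"
  shows "pairing w (monom 1 (2 * k) * rec_OPS a b (2 * n)) = - (\<kappa> * even_pairing a b n k) \<and>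
    pairing w (monom 1 (2 * k + 1) * rec_OPS a b (2 * n)) = \<kappa> * even_pairing a b n k \<and>
    pairing w (monom 1 (2 * k) * rec_OPS a b (2 * n + 1)) = 0 \<and>
    pairing w (monom 1 (2 * k + 1) * rec_OPS a b (2 * n + 1)) = \<kappa> * odd_pairing a b n k"
proof (induction n arbitrary: k)
  case 0
  have B: "Beta (a + k) b - Beta (a + k + 1) b = Beta (a + k) (b + 1)"
  proof -
    have "1 - (a + k) / (a + k + b) = b / (a + k + b)"
      using a b by (simp add: field_simps)
    then show ?thesis
      using Beta_Suc_left[of "a + k" b] Beta_Suc_right[of "a + k" b] a b
      by (metis add_pos_nonneg left_diff_distrib mult_1 of_nat_0_le_iff)
  qed
  have odd: "pairing w (monom 1 (2 * k) * [:1, 1:]) = 0"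
    "pairing w (monom 1 (2 * k + 1) * [:1, 1:]) = \<kappa> * (Beta (a + k) b - Beta (a + k + 1) b)"
    using pairing_monom_linear_mult[of "2 * k" 1 1] pairing_monom_linear_mult[of "2 * k + 1" 1 1]
      even_moment[of k] even_moment[of "Suc k"] odd_moment[of k]
    by (simp_all add: algebra_simps)
  have val: "even_pairing a b 0 k = Beta (a + k) b" "odd_pairing a b 0 k = Beta (a + k) (b + 1)"
    using ab by (simp_all add: even_pairing_def odd_pairing_def jacobi_factor_def)
  show ?case
    using odd even_moment[of k] odd_moment[of k] unfolding val B by simp
next
  case (Suc n)
  have rec: "pairing w (monom 1 m * rec_OPS a b (Suc (Suc j))) =
      - ((-1) ^ j) * pairing w (monom 1 m * rec_OPS a b (Suc j)) +
      pairing w (monom 1 (Suc m) * rec_OPS a b (Suc j)) -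
      rec_coeff a b (Suc j) * pairing w (monom 1 m * rec_OPS a b j)" for m j
    unfolding rec_OPS.simps right_diff_distrib pairing_diff pairing_monom_linear_mult
      mult_smult_right pairing_smult by simp
  note IH = Suc[THEN conjunct1] Suc[THEN conjunct2, THEN conjunct1]
    Suc[THEN conjunct2, THEN conjunct2, THEN conjunct1]
    Suc[THEN conjunct2, THEN conjunct2, THEN conjunct2]
  have e0: "pairing w (monom 1 (2 * k) * rec_OPS a b (2 * n + 2)) = - (\<kappa> * even_pairing a b (Suc n) k)" for k
    using rec[of "2 * k" "2 * n"] IH[of k] unfolding even_pairing_Suc[OF a b ab]
    by (simp add: algebra_simps del: rec_OPS.simps)
  have e1: "pairing w (monom 1 (2 * k + 1) * rec_OPS a b (2 * n + 2)) = \<kappa> * even_pairing a b (Suc n) k" for k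
    using rec[of "2 * k + 1" "2 * n"] IH[of k] IH(3)[of "Suc k"] unfolding even_pairing_Suc[OF a b ab]
    by (simp add: algebra_simps del: rec_OPS.simps)
  \<comment> \<open>For odd degrees the linear factor of the recurrence is \<open>x + 1\<close>, and the two values just found
    for \<open>2 * n + 2\<close> are opposite.\<close>
  have o0: "pairing w (monom 1 (2 * k) * rec_OPS a b (2 * n + 3)) = 0"
    using rec[of "2 * k" "2 * n + 1"] IH[of k] e0[of k] e1[of k]
    by (simp add: numeral_3_eq_3 del: rec_OPS.simps)
  have o1: "pairing w (monom 1 (2 * k + 1) * rec_OPS a b (2 * n + 3)) = \<kappa> * odd_pairing a b (Suc n) k"
    using rec[of "2 * k + 1" "2 * n + 1"] IH[of k] e0[of "Suc k"] e1[of k]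
    unfolding odd_pairing_Suc[OF a b ab]
    by (simp add: numeral_3_eq_3 algebra_simps del: rec_OPS.simps)
  show ?case
    using e0 e1 o0 o1 by (simp add: numeral_3_eq_3 del: rec_OPS.simps)
qed

text \<open>
  The falling factorial of length \<open>n\<close> vanishes at \<open>k < n\<close> and is positive at \<open>k = n\<close>.  In degree
  \<open>2n\<close> or \<open>2n + 1\<close>, the exponents \<open>2k\<close> and \<open>2k + 1\<close> below the degree have \<open>k < n\<close>, except for
  \<open>2n < 2n + 1\<close>, where the pairing is zero for the parity reason.
\<close>

lemma monic_OPS_rec_OPS:
  assumes a: "a > 0" and b: "b > 0" and ab: "a + b > 1" and "\<kappa> > 0"
    and "\<And>k. pairing w (monom 1 (2 * k)) = - (\<kappa> * Beta (a + k) b)"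
    and "\<And>k. pairing w (monom 1 (2 * k + 1)) = \<kappa> * Beta (a + k) b"
  shows "monic_OPS w (rec_OPS a b)"
proof -
  note pairings = rec_OPS_pairings[OF a b ab assms(5,6)]
  have zero: "even_pairing a b n k = 0" "odd_pairing a b n k = 0" if "k < n" for n k
    using that by (simp_all add: even_pairing_def odd_pairing_def falling_factorial_eq_0)
  have nonzero: "even_pairing a b n n \<noteq> 0" "odd_pairing a b n n \<noteq> 0" for n
    using jacobi_factor_pos[OF ab, of n] falling_factorial_pos[of n] a b ab
      Beta_real_pos[of "a + n" "b + n"] Beta_real_pos[of "a + n" "b + n + 1"]
    by (auto simp: even_pairing_def odd_pairing_def)
  have "(\<forall>m<n. pairing w (monom 1 m * rec_OPS a b n) = 0) \<and>
      pairing w (monom 1 n * rec_OPS a b n) \<noteq> 0" for n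
  proof (cases "even n")
    case True
    then obtain j where n: "n = 2 * j" by (elim evenE)
    have "pairing w (monom 1 m * rec_OPS a b n) = 0" if "m < n" for m
      using pairings[of "m div 2" j] zero[of "m div 2" j] that n
      by (cases "even m") (auto elim!: evenE oddE)
    then show ?thesis
      using pairings[of j j] nonzero[of j] n \<open>\<kappa> > 0\<close> by auto
  next
    case False
    then obtain j where n: "n = 2 * j + 1" by (elim oddE)
    have "pairing w (monom 1 m * rec_OPS a b n) = 0" if "m < n" for m
      using pairings[of "m div 2" j] zero[of "m div 2" j] that n
      by (cases "even m") (auto elim!: evenE oddE)
    then show ?thesis
      using pairings[of j j] nonzero[of j] n \<open>\<kappa> > 0\<close> by auto
  qed
  then show ?thesis
    unfolding monic_OPS_iff_pairing using rec_OPS_monic by blast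
qed

end

section \<open>The sign-changing weight\<close>

text \<open>
  Moving the polynomial factor \<open>x^(2q+1) (1 - x)\<close> from the weight into the polynomial reduces every
  integral to the symmetric weight.
\<close>

lemma weight_mult_poly:
  "weight \<alpha> q x * poly p x = ultra \<alpha> x * poly (monom 1 (2 * q + 1) * ([:1, -1:] * p)) x"
  by (simp add: weight_def ultra_def poly_monom algebra_simps)

lemma weight_moment_functional:
  assumes "\<alpha> > -1"
  shows "moment_functional (weight \<alpha> q)"
proof
  interpret u: moment_functional "ultra \<alpha>"
    using ultra_moment_functional[OF assms] .
  show "set_integrable lborel {-1..1} (\<lambda>x. weight \<alpha> q x * poly p x)" for p
    unfolding weight_mult_poly by (rule u.integrable)
qed

lemma weight_moment:
  assumes "\<alpha> > -1"
  shows "pairing (weight \<alpha> q) (monom 1 m) =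
    pairing (ultra \<alpha>) (monom 1 (2 * q + 1 + m)) - pairing (ultra \<alpha>) (monom 1 (2 * q + 2 + m))"
proof -
  interpret u: moment_functional "ultra \<alpha>"
    using ultra_moment_functional[OF assms] .
  have "monom 1 (2 * q + 1) * ([:1, -1:] * monom 1 m) =
      monom (1::real) (2 * q + 1 + m) - monom 1 (2 * q + 2 + m)"
    by (simp add: mult_monom monom_Suc algebra_simps)
  then show ?thesis
    unfolding pairing_def[of "weight \<alpha> q"] weight_mult_poly
    by (simp only: u.pairing_diff flip: pairing_def)
qed

lemma monic_OPS_weight:
  assumes "\<alpha> > -1"
  shows "monic_OPS (weight \<alpha> q) (rec_OPS (q + 3/2) (\<alpha> + 1))"
proof -
  interpret moment_functional "weight \<alpha> q"
    using weight_moment_functional[OF assms] .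
  obtain \<kappa> where \<kappa>: "\<kappa> > 0"
    "\<And>j. pairing (ultra \<alpha>) (monom 1 (2 * j)) = \<kappa> * Beta (real j + 1/2) (\<alpha> + 1)"
    using ultra_even_moment[OF assms] by blast
  show ?thesis
  proof (rule monic_OPS_rec_OPS[OF _ _ _ \<kappa>(1)])
    show "pairing (weight \<alpha> q) (monom 1 (2 * k)) = - (\<kappa> * Beta (q + 3/2 + k) (\<alpha> + 1))" for k
      using weight_moment[OF assms, of q "2 * k"] \<kappa>(2)[of "q + k + 1"]
        ultra_odd_moment[OF assms, of "q + k"]
      by (simp add: algebra_simps)
    show "pairing (weight \<alpha> q) (monom 1 (2 * k + 1)) = \<kappa> * Beta (q + 3/2 + k) (\<alpha> + 1)" for k
      using weight_moment[OF assms, of q "2 * k + 1"] \<kappa>(2)[of "q + k + 1"]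
        ultra_odd_moment[OF assms, of "q + k + 1"]
      by (simp add: algebra_simps)
  qed (use assms in auto)
qed

theorem proposition3p2:
  fixes \<alpha> :: real and q :: nat
  assumes "\<alpha> > -1"
  shows "(\<exists>!P. monic_OPS (weight \<alpha> q) P) \<and>
    (\<forall>P. monic_OPS (weight \<alpha> q) P \<longrightarrow>
      (\<exists>\<beta> \<gamma> :: nat \<Rightarrow> real.
        (\<forall>n. \<beta> n = (-1) ^ (n + 1)) \<and>
        (\<forall>n\<ge>1. \<gamma> (2 * n) =
           - 2 * (real n * (2 * real n + 2 * real q + 1) /
             ((4 * real n + 2 * \<alpha> + 2 * real q + 1) * (4 * real n + 2 * \<alpha> + 2 * real q + 3)))) \<and>
        (\<forall>n. \<gamma> (2 * n + 1) =
           - 2 * ((real n + \<alpha> + 1) * (2 * real n + 2 * \<alpha> + 2 * real q + 3) /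
             ((4 * real n + 2 * \<alpha> + 2 * real q + 3) * (4 * real n + 2 * \<alpha> + 2 * real q + 5)))) \<and>
        P 0 = 1 \<and>
        P 1 = [:- \<beta> 0, 1:] \<and>
        (\<forall>n. P (n + 2) = [:- \<beta> (n + 1), 1:] * P (n + 1) - smult (\<gamma> (n + 1)) (P n))))"
proof -
  interpret moment_functional "weight \<alpha> q"
    using weight_moment_functional[OF assms] .
  let ?a = "real q + 3/2" and ?b = "\<alpha> + 1"
  let ?Q = "rec_OPS ?a ?b"
  have Q: "monic_OPS (weight \<alpha> q) ?Q"
    using monic_OPS_weight[OF assms] .
  \<comment> \<open>Each of the two linear factors in the denominators of the theorem is twice the corresponding
    factor in \<open>rec_coeff\<close>; the resulting \<open>4\<close> cancels against the \<open>2\<close> in front and a \<open>2\<close> from the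
    numerator.\<close>
  have even: "rec_coeff ?a ?b (2 * n) =
       - 2 * (real n * (2 * real n + 2 * real q + 1) /
         ((4 * real n + 2 * \<alpha> + 2 * real q + 1) * (4 * real n + 2 * \<alpha> + 2 * real q + 3)))"
    if "n \<ge> 1" for n
  proof -
    have "4 * real n + 2 * \<alpha> + 2 * real q + 1 > 0"
      using that assms by simp
    then show ?thesis
      by (simp add: rec_coeff_def Let_def divide_simps) (simp add: algebra_simps)
  qed
  have odd: "rec_coeff ?a ?b (2 * n + 1) =
       - 2 * ((real n + \<alpha> + 1) * (2 * real n + 2 * \<alpha> + 2 * real q + 3) /
         ((4 * real n + 2 * \<alpha> + 2 * real q + 3) * (4 * real n + 2 * \<alpha> + 2 * real q + 5)))" for n
  proof -
    have "4 * real n + 2 * \<alpha> + 2 * real q + 3 > 0"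
      using assms by simp
    then show ?thesis
      by (simp add: rec_coeff_def Let_def divide_simps) (simp add: algebra_simps)
  qed
  have rec: "?Q (n + 2) = [:- ((-1) ^ (n + 1 + 1)), 1:] * ?Q (n + 1) -
      smult (rec_coeff ?a ?b (n + 1)) (?Q n)" for n
    by simp
  have "\<exists>\<beta> \<gamma> :: nat \<Rightarrow> real.
        (\<forall>n. \<beta> n = (-1) ^ (n + 1)) \<and>
        (\<forall>n\<ge>1. \<gamma> (2 * n) =
           - 2 * (real n * (2 * real n + 2 * real q + 1) /
             ((4 * real n + 2 * \<alpha> + 2 * real q + 1) * (4 * real n + 2 * \<alpha> + 2 * real q + 3)))) \<and>
        (\<forall>n. \<gamma> (2 * n + 1) =
           - 2 * ((real n + \<alpha> + 1) * (2 * real n + 2 * \<alpha> + 2 * real q + 3) /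
             ((4 * real n + 2 * \<alpha> + 2 * real q + 3) * (4 * real n + 2 * \<alpha> + 2 * real q + 5)))) \<and>
        ?Q 0 = 1 \<and>
        ?Q 1 = [:- \<beta> 0, 1:] \<and>
        (\<forall>n. ?Q (n + 2) = [:- \<beta> (n + 1), 1:] * ?Q (n + 1) - smult (\<gamma> (n + 1)) (?Q n))"
    by (rule exI[of _ "\<lambda>n. (-1) ^ (n + 1)"], rule exI[of _ "rec_coeff ?a ?b"])
       (intro conjI allI impI even odd rec; simp)
  then show ?thesis
    using Q monic_OPS_unique by (metis (no_types, lifting))
qed

end
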